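(* Let $G$ be a locally compact (Hausdorff) group and let $\Gamma$ be a subsemigroup of $\mathrm{Aut}(G)$. Let $K$ be a compact metrizable $\Gamma$-invariant subgroup of $G$. Then the $\Gamma$-action on $G$ has [MOC] if and only if the $\Gamma$-actions on both $K$ and $G/K$ have [MOC].
   Context: $\mathrm{Aut}(G)$ is the group of bicontinuous group automorphisms of $G$. A subgroup $H$ of $G$ is $\Gamma$-invariant if $\gamma(H)=H$ for all $\gamma\in\Gamma$. For a closed $\Gamma$-invariant subgroup $H$ (not necessarily normal), $\Gamma$ acts on the homogeneous space $G/H=\{xH\mid x\in G\}$ (quotient topology) by $\gamma(xH)=\gamma(x)H$. An action of a semigroup $\Gamma$ by continuous self-maps on a Hausdorff space $X$ has [MOC] (minimal orbit closures) if the closure of every $\Gamma$-orbit is a minimal closed $\Gamma$-invariant set, i.e. for $x,y\in X$, if $y\in\overline{\Gamma(x)}$ then $\overline{\Gamma(y)}=\overline{\Gamma(x)}$, where $\Gamma(x)=\{\gamma(x)\mid\gamma\in\Gamma\}$. *)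

theory Defs
  imports "HOL-Analysis.Analysis" "HOL-Algebra.Bij" "HOL-Algebra.Left_Coset"
begin

locale topological_group = group G for G (structure) +
  fixes T :: "'a topology"
  assumes topspace_eq_carrier: "topspace T = carrier G"
    and continuous_map_mult: "continuous_map (prod_topology T T) T (\<lambda>(x, y). x \<otimes> y)"
    and continuous_map_inv: "continuous_map T T (\<lambda>x. inv x)"

text \<open>As in \<^term>\<open>AutoGroup G\<close>, automorphisms are extensional functions on the carrier, and the
  group operation is composition restricted to the carrier.\<close>

definition top_AutoGroup :: "('a, 'b) monoid_scheme \<Rightarrow> 'a topology \<Rightarrow> ('a \<Rightarrow> 'a) monoid" where
  "top_AutoGroup G T = AutoGroup G \<lparr>carrier := {\<gamma> \<in> auto G. homeomorphic_map T T \<gamma>}\<rparr>"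

text \<open>The empty set counts as a subsemigroup.\<close>

definition subsemigroup :: "'a set \<Rightarrow> ('a, 'b) monoid_scheme \<Rightarrow> bool" where
  "subsemigroup S M \<longleftrightarrow> S \<subseteq> carrier M \<and> (\<forall>x \<in> S. \<forall>y \<in> S. x \<otimes>\<^bsub>M\<^esub> y \<in> S)"

definition invariant_under :: "('a \<Rightarrow> 'a) set \<Rightarrow> 'a set \<Rightarrow> bool" where
  "invariant_under \<Gamma> H \<longleftrightarrow> (\<forall>\<gamma> \<in> \<Gamma>. \<gamma> ` H = H)"

definition semigroup_orbit :: "('g \<Rightarrow> 'x \<Rightarrow> 'x) \<Rightarrow> 'g set \<Rightarrow> 'x \<Rightarrow> 'x set" where
  "semigroup_orbit act \<Gamma> x = {act \<gamma> x | \<gamma>. \<gamma> \<in> \<Gamma>}"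

text \<open>Minimal orbit closures. Since \<open>\<Gamma>\<close> need not contain the identity, a point need not
  belong to its own orbit closure.\<close>

definition MOC :: "'x topology \<Rightarrow> ('g \<Rightarrow> 'x \<Rightarrow> 'x) \<Rightarrow> 'g set \<Rightarrow> bool" where
  "MOC X act \<Gamma> \<longleftrightarrow>
     (\<forall>x \<in> topspace X. \<forall>y \<in> topspace X.
        y \<in> X closure_of (semigroup_orbit act \<Gamma> x) \<longrightarrow>
        X closure_of (semigroup_orbit act \<Gamma> y) = X closure_of (semigroup_orbit act \<Gamma> x))"

definition coset_topology :: "('a, 'b) monoid_scheme \<Rightarrow> 'a topology \<Rightarrow> 'a set \<Rightarrow> 'a set topology" where
  "coset_topology G T H =
     topology (\<lambda>U. U \<subseteq> lcosets\<^bsub>G\<^esub> H \<and> openin T {x \<in> carrier G. x <#\<^bsub>G\<^esub> H \<in> U})"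

text \<open>The induced action on cosets is taking images; see \<open>coset_action_l_coset\<close>.\<close>

definition coset_action :: "('a \<Rightarrow> 'a) \<Rightarrow> 'a set \<Rightarrow> 'a set" where
  "coset_action \<gamma> C = \<gamma> ` C"

lemma coset_action_l_coset:
  assumes "\<gamma> \<in> auto G" "\<gamma> ` H = H" "H \<subseteq> carrier G" "x \<in> carrier G"
  shows "coset_action \<gamma> (x <#\<^bsub>G\<^esub> H) = \<gamma> x <#\<^bsub>G\<^esub> H"
proof -
  have "\<gamma> (x \<otimes>\<^bsub>G\<^esub> h) = \<gamma> x \<otimes>\<^bsub>G\<^esub> \<gamma> h" if "h \<in> H" for h
    using that assms by (auto simp: auto_def hom_def)
  then have "\<gamma> ` (x <#\<^bsub>G\<^esub> H) = \<gamma> x <#\<^bsub>G\<^esub> (\<gamma> ` H)"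
    by (auto simp: l_coset_def image_iff)
  then show ?thesis
    using assms(2) by (simp add: coset_action_def)
qed

lemma openin_coset_topology:
  "openin (coset_topology G T H) U \<longleftrightarrow>
     U \<subseteq> lcosets\<^bsub>G\<^esub> H \<and> openin T {x \<in> carrier G. x <#\<^bsub>G\<^esub> H \<in> U}"
proof -
  have "istopology (\<lambda>U. U \<subseteq> lcosets\<^bsub>G\<^esub> H \<and> openin T {x \<in> carrier G. x <#\<^bsub>G\<^esub> H \<in> U})"
    unfolding istopology_def
  proof (intro conjI allI impI)
    fix S U
    assume "S \<subseteq> lcosets\<^bsub>G\<^esub> H \<and> openin T {x \<in> carrier G. x <#\<^bsub>G\<^esub> H \<in> S}"
      and "U \<subseteq> lcosets\<^bsub>G\<^esub> H \<and> openin T {x \<in> carrier G. x <#\<^bsub>G\<^esub> H \<in> U}"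
    moreover have "{x \<in> carrier G. x <#\<^bsub>G\<^esub> H \<in> S \<inter> U} =
        {x \<in> carrier G. x <#\<^bsub>G\<^esub> H \<in> S} \<inter> {x \<in> carrier G. x <#\<^bsub>G\<^esub> H \<in> U}"
      by blast
    ultimately show "S \<inter> U \<subseteq> lcosets\<^bsub>G\<^esub> H" "openin T {x \<in> carrier G. x <#\<^bsub>G\<^esub> H \<in> S \<inter> U}"
      by auto
  next
    fix \<K>
    assume *: "\<forall>U\<in>\<K>. U \<subseteq> lcosets\<^bsub>G\<^esub> H \<and> openin T {x \<in> carrier G. x <#\<^bsub>G\<^esub> H \<in> U}"
    then show "\<Union>\<K> \<subseteq> lcosets\<^bsub>G\<^esub> H"
      by blast
    have "{x \<in> carrier G. x <#\<^bsub>G\<^esub> H \<in> \<Union>\<K>} = (\<Union>U\<in>\<K>. {x \<in> carrier G. x <#\<^bsub>G\<^esub> H \<in> U})"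
      by blast
    then show "openin T {x \<in> carrier G. x <#\<^bsub>G\<^esub> H \<in> \<Union>\<K>}"
      using * by auto
  qed
  then show ?thesis
    by (simp add: coset_topology_def)
qed

lemma (in topological_group) quotient_map_coset_topology:
  "quotient_map T (coset_topology G T H) (\<lambda>x. x <# H)"
proof -
  have "{x \<in> carrier G. x <# H \<in> lcosets H} = topspace T"
    by (auto simp: LCOSETS_def topspace_eq_carrier)
  then have "openin (coset_topology G T H) (lcosets H)"
    by (simp add: openin_coset_topology)
  then have "topspace (coset_topology G T H) = lcosets H"
    by (metis openin_coset_topology openin_subset openin_topspace subset_antisym)
  then show ?thesis
    by (auto simp: quotient_map_def openin_coset_topology topspace_eq_carrier LCOSETS_def)
qed

end

theory Submission
  imports Defs
begin

text \<open>
  Why the theorem is true. Write \<open>\<pi>\<close> for the projection \<open>G \<rightarrow> G/K\<close>. Since \<open>K\<close> is compact, \<open>\<pi>\<close> is a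
  closed map (\<open>closed_map_coset_projection\<close>), so it carries orbit closures onto orbit closures.

  The passage from \<open>G\<close> to \<open>K\<close> is a restriction to a closed invariant subset. For the passage from
  \<open>G\<close> to \<open>G/K\<close>, a point of the orbit closure of \<open>\<pi> x\<close> is \<open>\<pi> y\<close> for some \<open>y\<close> in the orbit closure
  of \<open>x\<close>; the orbit closures of \<open>x\<close> and \<open>y\<close> coincide, and hence so do their images.

  Conversely, let \<open>y\<close> lie in the orbit closure of \<open>x\<close>; the aim is that \<open>x\<close> lies in that of \<open>y\<close>. By
  hypothesis \<open>\<pi> x\<close> and \<open>\<pi> y\<close> have the same orbit closure in \<open>G/K\<close>. It contains \<open>\<pi> x\<close> itself: this
  needs an argument, as \<open>\<Gamma>\<close> may lack an identity, and comes from the invertibility of the action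
  (\<open>MOC_imp_mem_orbit_closure\<close>). Lifting \<open>\<pi> x\<close> gives \<open>k \<in> K\<close> such that \<open>x k\<close> lies in the orbit
  closure of \<open>y\<close>, and therefore in that of \<open>x\<close>. It remains to return from \<open>x k\<close> to \<open>x\<close> inside the
  fibre \<open>x K\<close> (\<open>return_within_fibre\<close>).

  For this, consider the maps \<open>x K \<rightarrow> x K\<close> that are pointwise limits of elements of \<open>\<Gamma>\<close>. They form
  a compact semigroup in which composition is continuous in the left factor, and some member sends
  \<open>x\<close> to \<open>x k\<close>, because \<open>K \<rightarrow> K\<close> functions form a compact space. Every member \<open>F\<close> is
  injective: \<open>F p = F q\<close> forces \<open>1\<close> into the orbit closure of \<open>p\<inverse> q \<in> K\<close>, whereas minimal orbit
  closures on \<open>K\<close> allow this only for \<open>p = q\<close>. By the Ellis--Numakura lemma every closed left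
  ideal contains an idempotent; an injective idempotent is the identity; so the left ideal generated
  by \<open>F\<close> contains the identity and \<open>F\<close> has a left inverse that is again a limit of elements of
  \<open>\<Gamma>\<close>. Applied to the \<open>F\<close> with \<open>F x = x k\<close>, it takes \<open>x k\<close> back to \<open>x\<close>.
\<close>

text \<open>The closure operation of a congruence shares its notation with the topological closure; only the
  latter occurs below.\<close>

no_notation eq_closure_of (\<open>closure'_of\<index>\<close>)

section \<open>Idempotents in compact right topological semigroups\<close>

text \<open>The Ellis--Numakura lemma. A minimal closed subsemigroup \<open>M\<close> exists by compactness and Zorn's
  lemma. For \<open>e \<in> M\<close>, minimality applies to \<open>M e\<close> and gives \<open>M e = M\<close>; so some \<open>a \<in> M\<close> satisfies
  \<open>a e = e\<close>. Minimality applies again to the set of all such \<open>a\<close>, which is thus all of \<open>M\<close> and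
  contains \<open>e\<close>.\<close>

lemma idempotent_in_compact_right_topological_semigroup:
  fixes mult :: "'a \<Rightarrow> 'a \<Rightarrow> 'a" (infixl "\<cdot>" 70)
  assumes compact: "compact_space X" and Hausdorff: "Hausdorff_space X"
    and nonempty: "topspace X \<noteq> {}"
    and closed: "\<And>a b. a \<in> topspace X \<Longrightarrow> b \<in> topspace X \<Longrightarrow> a \<cdot> b \<in> topspace X"
    and assoc: "\<And>a b c. \<lbrakk>a \<in> topspace X; b \<in> topspace X; c \<in> topspace X\<rbrakk> \<Longrightarrow> a \<cdot> b \<cdot> c = a \<cdot> (b \<cdot> c)"
    and cont: "\<And>b. b \<in> topspace X \<Longrightarrow> continuous_map X X (\<lambda>a. a \<cdot> b)"
  shows "\<exists>e \<in> topspace X. e \<cdot> e = e"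
proof -
  define \<A> where "\<A> = {C. closedin X C \<and> C \<noteq> {} \<and> (\<forall>a\<in>C. \<forall>b\<in>C. a \<cdot> b \<in> C)}"
  have "\<exists>M\<in>\<A>. \<forall>C\<in>\<A>. C \<subseteq> M \<longrightarrow> C = M"
  proof (rule predicate_Zorn [where P = "\<lambda>B C. C \<subseteq> B"])
    show "partial_order_on \<A> (relation_of (\<lambda>B C. C \<subseteq> B) \<A>)"
      by (auto simp: partial_order_on_def preorder_on_def refl_on_def trans_def antisym_def
          relation_of_def)
  next
    fix \<C>
    assume chain: "\<C> \<in> Chains (relation_of (\<lambda>B C. C \<subseteq> B) \<A>)"
    have sub: "\<C> \<subseteq> \<A>"
      using chain by (rule Chains_relation_of)
    have total: "subset.chain \<A> \<C>"
      using chain sub by (auto simp: subset.chain_def Chains_def relation_of_def)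
    show "\<exists>U\<in>\<A>. \<forall>C\<in>\<C>. U \<subseteq> C"
    proof (cases "\<C> = {}")
      case True
      have "topspace X \<in> \<A>"
        using closed nonempty by (auto simp: \<A>_def)
      then show ?thesis
        using True by blast
    next
      case False
      have "\<Inter>\<C> \<noteq> {}"
      proof -
        have "\<Inter>\<F> \<noteq> {}" if "finite \<F>" "\<F> \<subseteq> \<C>" for \<F>
        proof (cases "\<F> = {}")
          case False
          have "subset.chain \<A> \<F>"
            using total that(2) unfolding subset.chain_def by blast
          then have "\<Inter>\<F> \<in> \<F>"
            using Inter_in_chain that(1) False by blast
          then show ?thesis
            using that(2) sub by (auto simp: \<A>_def)
        qed auto
        moreover have "\<forall>C\<in>\<C>. closedin X C"
          using sub by (auto simp: \<A>_def)
        ultimately show ?thesis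
          using compact [unfolded compact_space_fip, rule_format, of \<C>] by simp
      qed
      moreover have "closedin X (\<Inter>\<C>)"
        using False sub by (intro closedin_Inter) (auto simp: \<A>_def)
      moreover have "\<forall>a\<in>\<Inter>\<C>. \<forall>b\<in>\<Inter>\<C>. a \<cdot> b \<in> \<Inter>\<C>"
        using sub by (auto simp: \<A>_def)
      ultimately have "\<Inter>\<C> \<in> \<A>"
        by (simp add: \<A>_def)
      then show ?thesis
        by blast
    qed
  qed
  then obtain M where M: "closedin X M" "M \<noteq> {}" "\<And>a b. a \<in> M \<Longrightarrow> b \<in> M \<Longrightarrow> a \<cdot> b \<in> M"
    and minimal: "\<And>C. C \<in> \<A> \<Longrightarrow> C \<subseteq> M \<Longrightarrow> C = M"
    by (auto simp: \<A>_def)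
  obtain e where e: "e \<in> M"
    using M(2) by blast
  have MX: "M \<subseteq> topspace X"
    by (rule closedin_subset [OF M(1)])
  then have eX: "e \<in> topspace X"
    using e by blast
  have "(\<lambda>a. a \<cdot> e) ` M = M"
  proof (rule minimal)
    show sub: "(\<lambda>a. a \<cdot> e) ` M \<subseteq> M"
      using M(3) e by blast
    have "compactin X ((\<lambda>a. a \<cdot> e) ` M)"
      using closedin_compact_space [OF compact M(1)] cont [OF eX] by (rule image_compactin)
    then have "closedin X ((\<lambda>a. a \<cdot> e) ` M)"
      using Hausdorff compactin_imp_closedin by blast
    moreover have "a \<cdot> e \<cdot> (b \<cdot> e) \<in> (\<lambda>a. a \<cdot> e) ` M" if "a \<in> M" "b \<in> M" for a b
    proof -
      have "a \<cdot> e \<cdot> (b \<cdot> e) = a \<cdot> e \<cdot> b \<cdot> e"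
        using that eX MX closed [of a e] assoc [of "a \<cdot> e" b e] by (simp add: subsetD)
      then show ?thesis
        using that e M(3) by blast
    qed
    ultimately show "(\<lambda>a. a \<cdot> e) ` M \<in> \<A>"
      using M(2) by (auto simp: \<A>_def)
  qed
  then have fix_nonempty: "{a \<in> M. a \<cdot> e = e} \<noteq> {}"
    using e by force
  have "{a \<in> M. a \<cdot> e = e} = M"
  proof (rule minimal)
    have "{a \<in> M. a \<cdot> e = e} = M \<inter> {a \<in> topspace X. a \<cdot> e = e}"
      using MX by blast
    moreover have "closedin X {a \<in> topspace X. a \<cdot> e = e}"
      using eX by (intro closedin_continuous_maps_eq [OF Hausdorff cont]) auto
    ultimately have "closedin X {a \<in> M. a \<cdot> e = e}"
      using M(1) by (simp add: closedin_Int)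
    moreover have "a \<cdot> b \<cdot> e = e" if "a \<in> M" "b \<in> M" "a \<cdot> e = e" "b \<cdot> e = e" for a b
      using that eX MX assoc by (metis subsetD)
    ultimately show "{a \<in> M. a \<cdot> e = e} \<in> \<A>"
      using fix_nonempty M(3) by (auto simp: \<A>_def)
  qed blast
  then show ?thesis
    using e eX by blast
qed

section \<open>Orbit closures of semigroup actions\<close>

text \<open>The composition law is only required on the space, since the elements of \<open>\<Gamma>\<close> may be functions
  with an arbitrary default value outside it.\<close>

locale continuous_semigroup_action =
  fixes X :: "'x topology" and act :: "'g \<Rightarrow> 'x \<Rightarrow> 'x" and \<Gamma> :: "'g set"
  assumes continuous_act: "\<gamma> \<in> \<Gamma> \<Longrightarrow> continuous_map X X (act \<gamma>)"
    and act_comp: "\<lbrakk>\<gamma> \<in> \<Gamma>; \<delta> \<in> \<Gamma>\<rbrakk> \<Longrightarrow> \<exists>\<epsilon>\<in>\<Gamma>. \<forall>x\<in>topspace X. act \<epsilon> x = act \<gamma> (act \<delta> x)"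
begin

abbreviation orbit_closure :: "'x \<Rightarrow> 'x set" where
  "orbit_closure x \<equiv> X closure_of semigroup_orbit act \<Gamma> x"

lemma act_closed: "\<gamma> \<in> \<Gamma> \<Longrightarrow> x \<in> topspace X \<Longrightarrow> act \<gamma> x \<in> topspace X"
  using continuous_act continuous_map_funspace by fastforce

lemma act_mem_orbit_closure:
  assumes "x \<in> topspace X" "\<gamma> \<in> \<Gamma>"
  shows "act \<gamma> x \<in> orbit_closure x"
proof -
  have "semigroup_orbit act \<Gamma> x \<subseteq> topspace X"
    using assms(1) act_closed by (auto simp: semigroup_orbit_def)
  then have "semigroup_orbit act \<Gamma> x \<subseteq> orbit_closure x"
    by (rule closure_of_subset)
  then show ?thesis
    using assms by (auto simp: semigroup_orbit_def)
qed

lemma orbit_closure_invariant: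
  assumes "x \<in> topspace X" "\<gamma> \<in> \<Gamma>" "y \<in> orbit_closure x"
  shows "act \<gamma> y \<in> orbit_closure x"
proof -
  have "act \<gamma> y \<in> act \<gamma> ` orbit_closure x"
    using assms(3) by blast
  also have "\<dots> \<subseteq> X closure_of (act \<gamma> ` semigroup_orbit act \<Gamma> x)"
    using assms continuous_act continuous_map_image_closure_subset by blast
  also have "\<dots> \<subseteq> orbit_closure x"
  proof (rule closure_of_mono)
    show "act \<gamma> ` semigroup_orbit act \<Gamma> x \<subseteq> semigroup_orbit act \<Gamma> x"
    proof
      fix z assume "z \<in> act \<gamma> ` semigroup_orbit act \<Gamma> x"
      then obtain \<delta> where \<delta>: "\<delta> \<in> \<Gamma>" "z = act \<gamma> (act \<delta> x)"
        by (auto simp: semigroup_orbit_def)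
      then obtain \<epsilon> where "\<epsilon> \<in> \<Gamma>" "act \<epsilon> x = z"
        using act_comp [OF assms(2)] assms(1) by metis
      then show "z \<in> semigroup_orbit act \<Gamma> x"
        by (auto simp: semigroup_orbit_def)
    qed
  qed
  finally show ?thesis .
qed

lemma orbit_closure_mono:
  assumes "x \<in> topspace X" "y \<in> orbit_closure x"
  shows "orbit_closure y \<subseteq> orbit_closure x"
proof (rule closure_of_minimal)
  show "semigroup_orbit act \<Gamma> y \<subseteq> orbit_closure x"
    using orbit_closure_invariant assms by (auto simp: semigroup_orbit_def)
qed simp

lemma MOC_eq:
  assumes "MOC X act \<Gamma>" "x \<in> topspace X" "y \<in> orbit_closure x"
  shows "orbit_closure y = orbit_closure x"
  using assms closure_of_subset_topspace [of X] by (fastforce simp: MOC_def)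

lemma MOC_if_symmetric:
  assumes "\<And>x y. \<lbrakk>x \<in> topspace X; y \<in> topspace X; y \<in> orbit_closure x\<rbrakk> \<Longrightarrow> x \<in> orbit_closure y"
  shows "MOC X act \<Gamma>"
  using assms orbit_closure_mono by (metis MOC_def subset_antisym)

text \<open>Let \<open>Y\<close> be the orbit closure of \<open>x\<close>, and \<open>W\<close> the set of all points whose orbit closure is \<open>Y\<close>.
  A point belongs to \<open>W\<close> as soon as one of its translates is in \<open>Y\<close>, so every \<open>\<gamma> \<in> \<Gamma>\<close> maps \<open>W\<close>
  onto \<open>Y\<close>. But \<open>\<gamma>\<gamma> \<in> \<Gamma>\<close> as well, whence \<open>\<gamma> Y = \<gamma>\<gamma> W = Y = \<gamma> W\<close>, and injectivity yields \<open>Y = W\<close>.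
  Without an identity in \<open>\<Gamma>\<close> this is the substitute for \<open>x\<close> being in its own orbit.\<close>

lemma MOC_imp_mem_orbit_closure:
  assumes MOC: "MOC X act \<Gamma>" and nonempty: "\<Gamma> \<noteq> {}"
    and surj: "\<And>\<gamma>. \<gamma> \<in> \<Gamma> \<Longrightarrow> act \<gamma> ` topspace X = topspace X"
    and inj: "\<And>\<gamma>. \<gamma> \<in> \<Gamma> \<Longrightarrow> inj_on (act \<gamma>) (topspace X)"
    and x: "x \<in> topspace X"
  shows "x \<in> orbit_closure x"
proof -
  define Y where "Y = orbit_closure x"
  define W where "W = {w \<in> topspace X. orbit_closure w = Y}"
  have YX: "Y \<subseteq> topspace X"
    by (simp add: Y_def closure_of_subset_topspace)
  have W_image: "act \<gamma> ` W = Y" if \<gamma>: "\<gamma> \<in> \<Gamma>" for \<gamma>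
  proof
    show "act \<gamma> ` W \<subseteq> Y"
      using act_mem_orbit_closure [OF _ \<gamma>] by (auto simp: W_def)
    show "Y \<subseteq> act \<gamma> ` W"
    proof
      fix y assume y: "y \<in> Y"
      then obtain w where w: "w \<in> topspace X" "y = act \<gamma> w"
        using surj [OF \<gamma>] YX by blast
      have "orbit_closure w = orbit_closure y"
        using MOC_eq [OF MOC w(1)] act_mem_orbit_closure [OF w(1) \<gamma>] w(2) by simp
      also have "\<dots> = Y"
        using MOC_eq [OF MOC x] y by (simp add: Y_def)
      finally show "y \<in> act \<gamma> ` W"
        using w by (auto simp: W_def)
    qed
  qed
  obtain \<gamma> where \<gamma>: "\<gamma> \<in> \<Gamma>"
    using nonempty by blast
  obtain \<epsilon> where \<epsilon>: "\<epsilon> \<in> \<Gamma>" "\<forall>x\<in>topspace X. act \<epsilon> x = act \<gamma> (act \<gamma> x)"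
    using act_comp \<gamma> by blast
  have WX: "W \<subseteq> topspace X"
    by (auto simp: W_def)
  have "act \<gamma> ` Y = act \<gamma> ` (act \<gamma> ` W)"
    using W_image [OF \<gamma>] by simp
  also have "\<dots> = act \<epsilon> ` W"
    using \<epsilon>(2) WX by (auto simp: image_iff) (metis subsetD)+
  also have "\<dots> = act \<gamma> ` W"
    using W_image \<gamma> \<epsilon>(1) by simp
  finally have "Y = W"
    using inj_on_image_eq_iff [OF inj [OF \<gamma>] YX WX] by blast
  then show ?thesis
    using x by (auto simp: W_def Y_def)
qed

end

section \<open>The enveloping semigroup of a compact set\<close>

text \<open>Pointwise limits on \<open>Q\<close> of elements of \<open>\<Gamma>\<close>; for compact invariant \<open>Q\<close> this is Ellis's
  enveloping semigroup. The sets \<open>Q\<close> of interest are single cosets of \<open>K\<close>, which \<open>\<Gamma>\<close> moves in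
  general, so the limits that map \<open>Q\<close> into itself are singled out where they occur.\<close>

definition enveloping_maps :: "'a topology \<Rightarrow> ('a \<Rightarrow> 'a) set \<Rightarrow> 'a set \<Rightarrow> ('a \<Rightarrow> 'a) set" where
  "enveloping_maps X \<Gamma> Q =
     product_topology (\<lambda>_. X) Q closure_of ((\<lambda>\<gamma>. restrict \<gamma> Q) ` \<Gamma>)"

lemma continuous_map_into_closure_of:
  assumes "continuous_map X Y f" "f ` A \<subseteq> Y closure_of B" "x \<in> X closure_of A"
  shows "f x \<in> Y closure_of B"
proof -
  have "f x \<in> Y closure_of (f ` A)"
    using continuous_map_image_closure_subset [OF assms(1)] assms(3) by blast
  also have "\<dots> \<subseteq> Y closure_of B"
    by (rule closure_of_minimal) (use assms(2) in auto)
  finally show ?thesis .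
qed

locale continuous_map_semigroup = continuous_semigroup_action X "\<lambda>\<gamma>. \<gamma>" \<Gamma>
  for X :: "'a topology" and \<Gamma> +
  fixes Q :: "'a set"
  assumes Q_subset: "Q \<subseteq> topspace X"
begin

abbreviation Env :: "('a \<Rightarrow> 'a) set" where
  "Env \<equiv> enveloping_maps X \<Gamma> Q"

abbreviation P :: "('a \<Rightarrow> 'a) topology" where
  "P \<equiv> product_topology (\<lambda>_. X) Q"

lemma Env_subset: "Env \<subseteq> (\<Pi>\<^sub>E q\<in>Q. topspace X)"
  using closure_of_subset_topspace [of P] by (auto simp: enveloping_maps_def)

lemma restrict_mem_Env:
  assumes "\<gamma> \<in> \<Gamma>"
  shows "restrict \<gamma> Q \<in> Env"
proof -
  have "(\<lambda>\<gamma>. restrict \<gamma> Q) ` \<Gamma> \<subseteq> topspace P"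
    using act_closed Q_subset by (auto simp: subset_iff)
  then show ?thesis
    using closure_of_subset [of _ P] assms unfolding enveloping_maps_def by blast
qed

lemma Env_apply:
  assumes "F \<in> Env" "q \<in> Q"
  shows "F q \<in> orbit_closure q"
proof -
  have "(\<lambda>F. F q) ` (\<lambda>\<gamma>. restrict \<gamma> Q) ` \<Gamma> \<subseteq> orbit_closure q"
    using assms(2) Q_subset act_mem_orbit_closure [of q] by (simp add: image_subset_iff subsetD)
  then show ?thesis
    using assms(1) unfolding enveloping_maps_def
    by (rule continuous_map_into_closure_of [OF continuous_map_product_projection [OF assms(2)]])
qed

lemma Env_compose_left:
  assumes \<gamma>: "\<gamma> \<in> \<Gamma>" and F: "F \<in> Env"
  shows "compose Q \<gamma> F \<in> Env"
  unfolding enveloping_maps_def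
proof (rule continuous_map_into_closure_of [where f = "compose Q \<gamma>" and X = P])
  show "continuous_map P P (compose Q \<gamma>)"
    unfolding continuous_map_componentwise
    using continuous_map_compose
      [OF continuous_map_product_projection [where X = "\<lambda>_. X"] continuous_act [OF \<gamma>]]
    by (auto simp: compose_def o_def)
  show "compose Q \<gamma> ` (\<lambda>\<gamma>. restrict \<gamma> Q) ` \<Gamma> \<subseteq> P closure_of (\<lambda>\<gamma>. restrict \<gamma> Q) ` \<Gamma>"
  proof clarify
    fix \<delta> assume "\<delta> \<in> \<Gamma>"
    then obtain \<epsilon> where \<epsilon>: "\<epsilon> \<in> \<Gamma>" "\<forall>x\<in>topspace X. \<epsilon> x = \<gamma> (\<delta> x)"
      using act_comp \<gamma> by blast
    then have "compose Q \<gamma> (restrict \<delta> Q) = restrict \<epsilon> Q"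
      using Q_subset by (auto simp: compose_def fun_eq_iff subset_iff)
    then show "compose Q \<gamma> (restrict \<delta> Q) \<in> P closure_of (\<lambda>\<gamma>. restrict \<gamma> Q) ` \<Gamma>"
      using restrict_mem_Env [OF \<epsilon>(1)] by (simp add: enveloping_maps_def)
  qed
  show "F \<in> P closure_of (\<lambda>\<gamma>. restrict \<gamma> Q) ` \<Gamma>"
    using F by (simp add: enveloping_maps_def)
qed

lemma continuous_map_precompose:
  assumes "F \<in> Q \<rightarrow> Q"
  shows "continuous_map P P (\<lambda>E. compose Q E F)"
  unfolding continuous_map_componentwise
  using assms by (auto simp: compose_def intro!: continuous_map_product_projection)

text \<open>Composition is in general continuous in its left factor only, so closure under it takes two steps: first the left
  factor is an element of \<open>\<Gamma>\<close>, which is continuous; then it runs through a limit, using that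
  precomposition with any fixed map \<open>F\<close> is continuous for pointwise convergence.\<close>

lemma Env_compose:
  assumes E: "E \<in> Env" and F: "F \<in> Env" "F \<in> Q \<rightarrow> Q"
  shows "compose Q E F \<in> Env"
  unfolding enveloping_maps_def
proof (rule continuous_map_into_closure_of [OF continuous_map_precompose [OF F(2)]])
  have "compose Q (restrict \<gamma> Q) F = compose Q \<gamma> F" for \<gamma> :: "'a \<Rightarrow> 'a"
    using F(2) by (auto simp: compose_def fun_eq_iff)
  then show "(\<lambda>E. compose Q E F) ` (\<lambda>\<gamma>. restrict \<gamma> Q) ` \<Gamma> \<subseteq> P closure_of (\<lambda>\<gamma>. restrict \<gamma> Q) ` \<Gamma>"
    using Env_compose_left [OF _ F(1)] by (auto simp: enveloping_maps_def)
  show "E \<in> P closure_of (\<lambda>\<gamma>. restrict \<gamma> Q) ` \<Gamma>"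
    using E by (simp add: enveloping_maps_def)
qed

text \<open>The left ideal generated by \<open>F\<close> is compact and so contains an idempotent. An injective
  idempotent is the identity, hence \<open>F\<close> has a left inverse among the limits of elements of \<open>\<Gamma>\<close>,
  which carries \<open>F q\<close> back to \<open>q\<close>.\<close>

proposition recurrence_from_injectivity:
  assumes Hausdorff: "Hausdorff_space X" and compact: "compactin X Q"
    and inj: "\<And>F. F \<in> Env \<Longrightarrow> F \<in> Q \<rightarrow> Q \<Longrightarrow> inj_on F Q"
    and F: "F \<in> Env" "F \<in> Q \<rightarrow> Q" and q: "q \<in> Q"
  shows "q \<in> orbit_closure (F q)"
proof -
  \<comment> \<open>\<open>S\<close> is the semigroup of limits preserving \<open>Q\<close>, and \<open>L\<close> its left ideal generated by \<open>F\<close>.\<close>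
  define S where "S = Env \<inter> (Q \<rightarrow>\<^sub>E Q)"
  define L where "L = (\<lambda>E. compose Q E F) ` S"
  have S_iff: "E \<in> S \<longleftrightarrow> E \<in> Env \<and> E \<in> Q \<rightarrow> Q" for E
    using Env_subset by (auto simp: S_def PiE_def)
  have S_comp: "compose Q D E \<in> S" if "D \<in> S" "E \<in> S" for D E
    using that Env_compose [of D E] unfolding S_iff by (auto simp: compose_def)
  have FS: "F \<in> S"
    using F S_iff by blast
  have LS: "L \<subseteq> S"
    using S_comp FS by (auto simp: L_def)
  have Hausdorff_P: "Hausdorff_space P"
    using Hausdorff by (simp add: Hausdorff_space_product_topology)
  have "compactin P S"
    unfolding S_def enveloping_maps_def Int_commute [of _ "Q \<rightarrow>\<^sub>E Q"]
    using compact by (intro compact_Int_closedin) (auto simp: compactin_PiE)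
  then have "compactin P L"
    unfolding L_def by (rule image_compactin [OF _ continuous_map_precompose [OF F(2)]])
  have topL: "topspace (subtopology P L) = L"
    using \<open>compactin P L\<close> compactin_subset_topspace by fastforce
  have L_closed: "compose Q D E \<in> L" if DE: "D \<in> L" "E \<in> L" for D E
  proof -
    obtain E' where E': "E' \<in> S" "E = compose Q E' F"
      using DE(2) by (auto simp: L_def)
    have "compose Q D E = compose Q (compose Q D E') F"
      unfolding E'(2) by (rule compose_assoc [OF F(2)])
    then show ?thesis
      using S_comp [OF _ E'(1)] DE(1) LS by (auto simp: L_def)
  qed
  have "\<exists>U \<in> topspace (subtopology P L). compose Q U U = U"
  proof (rule idempotent_in_compact_right_topological_semigroup [where mult = "compose Q"], unfold topL)
    show "compact_space (subtopology P L)"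
      using \<open>compactin P L\<close> by (simp add: compact_space_subtopology)
    show "Hausdorff_space (subtopology P L)"
      using Hausdorff_P by (rule Hausdorff_space_subtopology)
    show "L \<noteq> {}"
      using FS by (auto simp: L_def)
    show "compose Q D E \<in> L" if "D \<in> L" "E \<in> L" for D E
      by (rule L_closed [OF that])
    show "compose Q (compose Q C D) E = compose Q C (compose Q D E)"
      if "C \<in> L" "D \<in> L" "E \<in> L" for C D E
      by (rule compose_assoc [symmetric]) (use that(3) LS S_iff in blast)
    show "continuous_map (subtopology P L) (subtopology P L) (\<lambda>D. compose Q D E)" if "E \<in> L" for E
    proof -
      have "E \<in> Q \<rightarrow> Q"
        using that LS S_iff by blast
      then show ?thesis
        using L_closed [OF _ that] topL continuous_map_precompose
        by (auto simp: continuous_map_in_subtopology continuous_map_from_subtopology)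
    qed
  qed
  then obtain E where E: "E \<in> S" "compose Q (compose Q E F) (compose Q E F) = compose Q E F"
    and EF: "compose Q E F \<in> S"
    using topL LS by (auto simp: L_def)
  have mem: "compose Q E F q \<in> Q"
    using EF q unfolding S_iff by blast
  have "compose Q E F (compose Q E F q) = compose Q E F q"
    using fun_cong [OF E(2), of q] unfolding compose_eq [OF q, of "compose Q E F" "compose Q E F"] .
  then have "compose Q E F q = q"
    using inj_onD [OF inj _ mem q] EF unfolding S_iff by blast
  then have "E (F q) = q"
    using q by (simp add: compose_def)
  then show ?thesis
    using Env_apply [of E "F q"] E(1) F(2) q S_iff by (metis Pi_mem)
qed

end

section \<open>The projection onto a coset space\<close>

context topological_group
begin

lemma continuous_map_group_mult:
  assumes "continuous_map X T f" "continuous_map X T g"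
  shows "continuous_map X T (\<lambda>x. f x \<otimes> g x)"
  using continuous_map_compose [OF continuous_map_pairedI [OF assms] continuous_map_mult]
  by (simp add: o_def)

lemma continuous_map_group_inv:
  assumes "continuous_map X T f"
  shows "continuous_map X T (\<lambda>x. inv f x)"
  using continuous_map_compose [OF assms continuous_map_inv] by (simp add: o_def)

lemma l_coset_eq_iff:
  assumes "subgroup K G" "x \<in> carrier G" "y \<in> carrier G"
  shows "x <# K = y <# K \<longleftrightarrow> (\<exists>k\<in>K. y \<otimes> k = x)"
proof
  assume "x <# K = y <# K"
  then have "x \<in> y <# K"
    using lcos_self [OF assms(2,1)] by simp
  then show "\<exists>k\<in>K. y \<otimes> k = x"
    by (auto simp: l_coset_def)
next
  assume "\<exists>k\<in>K. y \<otimes> k = x"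
  then have "x \<in> y <# K"
    by (auto simp: l_coset_def)
  then show "x <# K = y <# K"
    using l_repr_independence [OF _ assms(3,1)] by simp
qed

lemma topspace_coset_topology: "topspace (coset_topology G T K) = (\<lambda>x. x <# K) ` carrier G"
  using quotient_imp_surjective_map [OF quotient_map_coset_topology] topspace_eq_carrier by simp

text \<open>For closed \<open>C\<close>, the saturation \<open>C K\<close> is the projection to \<open>G\<close> of the closed set of all
  \<open>(x, k) \<in> G \<times> K\<close> with \<open>x k \<in> C\<close>; projecting along the compact factor \<open>K\<close> is a closed map.\<close>

lemma closed_map_coset_projection:
  assumes K: "subgroup K G" "compactin T K"
  shows "closed_map T (coset_topology G T K) (\<lambda>x. x <# K)"
  unfolding closed_map_def
proof (intro allI impI)
  fix C assume C: "closedin T C"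
  have KG: "K \<subseteq> carrier G"
    using K(1) by (rule subgroup.subset)
  define Z where "Z = {p \<in> topspace (prod_topology T (subtopology T K)). fst p \<otimes> snd p \<in> C}"
  have "continuous_map (prod_topology T (subtopology T K)) T (\<lambda>p. fst p \<otimes> snd p)"
    using continuous_map_snd [of T "subtopology T K"]
    by (intro continuous_map_group_mult continuous_map_fst)
       (simp add: continuous_map_in_subtopology)
  then have "closedin (prod_topology T (subtopology T K)) Z"
    unfolding Z_def using C by (rule closedin_continuous_map_preimage)
  then have "closedin T (fst ` Z)"
    using closed_map_fst [of "subtopology T K" T] K(2)
    by (simp add: closed_map_def compact_space_subtopology)
  moreover have "fst ` Z = {x \<in> topspace T. x <# K \<in> (\<lambda>x. x <# K) ` C}"
  proof -
    have "C \<subseteq> carrier G"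
      using closedin_subset [OF C] topspace_eq_carrier by simp
    then have "x <# K \<in> (\<lambda>x. x <# K) ` C \<longleftrightarrow> (\<exists>k\<in>K. x \<otimes> k \<in> C)" if "x \<in> carrier G" for x
    proof -
      have "x <# K \<in> (\<lambda>x. x <# K) ` C \<longleftrightarrow> (\<exists>c\<in>C. c <# K = x <# K)"
        by (auto simp: image_iff)
      also have "\<dots> \<longleftrightarrow> (\<exists>c\<in>C. \<exists>k\<in>K. x \<otimes> k = c)"
        using l_coset_eq_iff [OF K(1) _ that] \<open>C \<subseteq> carrier G\<close> by (intro bex_cong) auto
      finally show ?thesis
        by auto
    qed
    moreover have "fst ` Z = {x \<in> carrier G. \<exists>k\<in>K. x \<otimes> k \<in> C}"
      using KG by (force simp: Z_def topspace_eq_carrier image_iff)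
    ultimately show ?thesis
      by (auto simp: topspace_eq_carrier)
  qed
  moreover have "(\<lambda>x. x <# K) ` C \<subseteq> topspace (coset_topology G T K)"
    using closedin_subset [OF C] by (auto simp: topspace_coset_topology topspace_eq_carrier)
  ultimately show "closedin (coset_topology G T K) ((\<lambda>x. x <# K) ` C)"
    using quotient_map_coset_topology [of K] by (simp add: quotient_map_closedin)
qed

end

section \<open>Semigroups of automorphisms and compact invariant subgroups\<close>

locale automorphism_semigroup = topological_group G T for G (structure) and T +
  fixes \<Gamma> :: "('a \<Rightarrow> 'a) set"
  assumes subsemigroup: "subsemigroup \<Gamma> (top_AutoGroup G T)"
begin

lemma
  assumes "\<gamma> \<in> \<Gamma>"
  shows in_auto: "\<gamma> \<in> auto G" and homeomorphic: "homeomorphic_map T T \<gamma>"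
  using assms subsemigroup by (auto simp: subsemigroup_def top_AutoGroup_def)

lemma bij: "\<gamma> \<in> \<Gamma> \<Longrightarrow> bij_betw \<gamma> (carrier G) (carrier G)"
  using in_auto by (auto simp: auto_def Bij_def)

lemma hom: "\<gamma> \<in> \<Gamma> \<Longrightarrow> \<gamma> \<in> hom G G"
  using in_auto by (auto simp: auto_def)

lemma group_hom: "\<gamma> \<in> \<Gamma> \<Longrightarrow> group_hom G G \<gamma>"
  using hom by (simp add: group_hom_def group_hom_axioms_def)

lemma compose_mem:
  assumes "\<gamma> \<in> \<Gamma>" "\<delta> \<in> \<Gamma>"
  shows "compose (carrier G) \<gamma> \<delta> \<in> \<Gamma>"
proof -
  have "\<gamma> \<otimes>\<^bsub>top_AutoGroup G T\<^esub> \<delta> \<in> \<Gamma>"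
    using subsemigroup assms by (simp add: subsemigroup_def)
  then show ?thesis
    using in_auto assms by (simp add: top_AutoGroup_def AutoGroup_def BijGroup_def auto_def)
qed

sublocale continuous_semigroup_action T "\<lambda>\<gamma>. \<gamma>" \<Gamma>
proof
  show "continuous_map T T \<gamma>" if "\<gamma> \<in> \<Gamma>" for \<gamma>
    using homeomorphic [OF that] homeomorphic_imp_continuous_map by blast
  show "\<exists>\<epsilon>\<in>\<Gamma>. \<forall>x\<in>topspace T. \<epsilon> x = \<gamma> (\<delta> x)" if "\<gamma> \<in> \<Gamma>" "\<delta> \<in> \<Gamma>" for \<gamma> \<delta>
    by (rule bexI [OF _ compose_mem [OF that]]) (simp add: topspace_eq_carrier compose_eq)
qed

lemma orbit_closure_subset: "orbit_closure x \<subseteq> carrier G"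
  using closure_of_subset_topspace [of T] by (simp add: topspace_eq_carrier)

end

locale automorphisms_with_compact_subgroup = automorphism_semigroup +
  fixes K :: "'a set"
  assumes Hausdorff: "Hausdorff_space T"
    and subgroup: "subgroup K G"
    and compact: "compactin T K"
    and invariant: "invariant_under \<Gamma> K"
begin

abbreviation \<pi> :: "'a \<Rightarrow> 'a set" where
  "\<pi> x \<equiv> x <# K"

abbreviation quotient :: "'a set topology" where
  "quotient \<equiv> coset_topology G T K"

lemma K_subset: "K \<subseteq> carrier G"
  using subgroup by (rule subgroup.subset)

lemma act_K: "\<gamma> \<in> \<Gamma> \<Longrightarrow> \<gamma> ` K = K"
  using invariant by (simp add: invariant_under_def)

lemma coset_action_\<pi>: "\<gamma> \<in> \<Gamma> \<Longrightarrow> x \<in> carrier G \<Longrightarrow> coset_action \<gamma> (\<pi> x) = \<pi> (\<gamma> x)"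
  by (rule coset_action_l_coset [OF in_auto act_K K_subset])

lemma orbit_closure_in_K:
  assumes "k \<in> K"
  shows "subtopology T K closure_of semigroup_orbit (\<lambda>\<gamma>. \<gamma>) \<Gamma> k = orbit_closure k"
proof -
  have sub: "semigroup_orbit (\<lambda>\<gamma>. \<gamma>) \<Gamma> k \<subseteq> K"
    using act_K assms by (auto simp: semigroup_orbit_def)
  moreover have "orbit_closure k \<subseteq> K"
    using sub compactin_imp_closedin [OF Hausdorff compact] by (rule closure_of_minimal)
  ultimately show ?thesis
    by (simp add: closure_of_subtopology Int_absorb1)
qed

lemma orbit_closure_in_quotient:
  assumes "x \<in> carrier G"
  shows "quotient closure_of semigroup_orbit coset_action \<Gamma> (\<pi> x) = \<pi> ` orbit_closure x"
proof -
  have "semigroup_orbit coset_action \<Gamma> (\<pi> x) = \<pi> ` semigroup_orbit (\<lambda>\<gamma>. \<gamma>) \<Gamma> x"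
    using coset_action_\<pi> assms by (auto simp: semigroup_orbit_def image_iff)
  moreover have "semigroup_orbit (\<lambda>\<gamma>. \<gamma>) \<Gamma> x \<subseteq> topspace T"
    using act_closed assms by (auto simp: semigroup_orbit_def topspace_eq_carrier)
  ultimately show ?thesis
    using closed_map_coset_projection [OF subgroup compact]
      quotient_imp_continuous_map [OF quotient_map_coset_topology]
      continuous_map_image_closure_subset closed_map_closure_of_image
    by (metis subset_antisym)
qed

sublocale quotient: continuous_semigroup_action quotient coset_action \<Gamma>
proof
  fix \<gamma> assume \<gamma>: "\<gamma> \<in> \<Gamma>"
  have "continuous_map T quotient (\<pi> \<circ> \<gamma>)"
    using continuous_act [OF \<gamma>] quotient_imp_continuous_map [OF quotient_map_coset_topology]
    by (rule continuous_map_compose)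
  then have "continuous_map T quotient (coset_action \<gamma> \<circ> \<pi>)"
    by (rule continuous_map_eq) (simp add: coset_action_\<pi> [OF \<gamma>] topspace_eq_carrier)
  then show "continuous_map quotient quotient (coset_action \<gamma>)"
    using continuous_compose_quotient_map_eq [OF quotient_map_coset_topology] by blast
next
  fix \<gamma> \<delta> assume \<gamma>: "\<gamma> \<in> \<Gamma>" and \<delta>: "\<delta> \<in> \<Gamma>"
  have "coset_action (compose (carrier G) \<gamma> \<delta>) (\<pi> x) = coset_action \<gamma> (coset_action \<delta> (\<pi> x))"
    if "x \<in> carrier G" for x
  proof -
    have "\<delta> x \<in> carrier G"
      using act_closed [OF \<delta>] that by (simp add: topspace_eq_carrier)
    then show ?thesis
      using that coset_action_\<pi> \<gamma> \<delta> compose_mem by (simp add: compose_eq)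
  qed
  then show "\<exists>\<epsilon>\<in>\<Gamma>. \<forall>C\<in>topspace quotient. coset_action \<epsilon> C = coset_action \<gamma> (coset_action \<delta> C)"
    using compose_mem [OF \<gamma> \<delta>] by (auto simp: topspace_coset_topology)
qed

lemma inj_on_coset_action:
  assumes \<gamma>: "\<gamma> \<in> \<Gamma>"
  shows "inj_on (coset_action \<gamma>) (topspace quotient)"
proof -
  have "\<Union>(topspace quotient) \<subseteq> carrier G"
    using l_coset_subset_G [OF K_subset] by (auto simp only: topspace_coset_topology)
  with bij_betw_imp_inj_on [OF bij [OF \<gamma>]] have "inj_on \<gamma> (\<Union>(topspace quotient))"
    by (rule inj_on_subset)
  then have "inj_on ((`) \<gamma>) (topspace quotient)"
    by (rule inj_on_image)
  then show ?thesis
    by (simp add: inj_on_def coset_action_def)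
qed

lemma coset_action_image_topspace:
  assumes \<gamma>: "\<gamma> \<in> \<Gamma>"
  shows "coset_action \<gamma> ` topspace quotient = topspace quotient"
proof -
  have "coset_action \<gamma> ` topspace quotient = \<pi> ` \<gamma> ` carrier G"
    using coset_action_\<pi> [OF \<gamma>] by (force simp: topspace_coset_topology image_image)
  then show ?thesis
    using bij_betw_imp_surj_on [OF bij [OF \<gamma>]] by (simp add: topspace_coset_topology)
qed

section \<open>Passing to the subgroup and to the quotient\<close>

lemma MOC_subgroup:
  assumes "MOC T (\<lambda>\<gamma>. \<gamma>) \<Gamma>"
  shows "MOC (subtopology T K) (\<lambda>\<gamma>. \<gamma>) \<Gamma>"
  unfolding MOC_def
proof (intro ballI impI)
  fix x y
  assume "x \<in> topspace (subtopology T K)" "y \<in> topspace (subtopology T K)"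
    and "y \<in> subtopology T K closure_of semigroup_orbit (\<lambda>\<gamma>. \<gamma>) \<Gamma> x"
  then show "subtopology T K closure_of semigroup_orbit (\<lambda>\<gamma>. \<gamma>) \<Gamma> y =
      subtopology T K closure_of semigroup_orbit (\<lambda>\<gamma>. \<gamma>) \<Gamma> x"
    using MOC_eq [OF assms, of x y] orbit_closure_in_K by simp
qed

lemma MOC_quotient:
  assumes "MOC T (\<lambda>\<gamma>. \<gamma>) \<Gamma>"
  shows "MOC quotient coset_action \<Gamma>"
  unfolding MOC_def
proof (intro ballI impI)
  fix C D
  assume C: "C \<in> topspace quotient"
    and D: "D \<in> quotient closure_of semigroup_orbit coset_action \<Gamma> C"
  obtain x where x: "x \<in> carrier G" "C = \<pi> x"
    using C by (auto simp: topspace_coset_topology)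
  obtain y where y: "y \<in> orbit_closure x" "D = \<pi> y"
    using D orbit_closure_in_quotient [OF x(1)] x(2) by auto
  have "y \<in> carrier G"
    using y(1) orbit_closure_subset by blast
  then show "quotient closure_of semigroup_orbit coset_action \<Gamma> D =
      quotient closure_of semigroup_orbit coset_action \<Gamma> C"
    using MOC_eq [OF assms _ y(1)] x y by (simp add: orbit_closure_in_quotient topspace_eq_carrier)
qed

section \<open>Returning within a fibre\<close>

text \<open>The orbit closure of \<open>k\<close> then equals that of \<open>\<one>\<close>, which is trivial, so an injective map fixing
  \<open>\<one>\<close> sends \<open>k\<close> to \<open>\<one>\<close>.\<close>

lemma MOC_subgroup_imp_distal:
  assumes MOC: "MOC (subtopology T K) (\<lambda>\<gamma>. \<gamma>) \<Gamma>"
    and k: "k \<in> K" "\<one> \<in> orbit_closure k"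
  shows "k = \<one>"
proof -
  have one: "\<one> \<in> K"
    using subgroup by (rule subgroup.one_closed)
  have "topspace (subtopology T K) = K"
    using K_subset by (simp add: topspace_eq_carrier Int_absorb1)
  then have "orbit_closure \<one> = orbit_closure k"
    using MOC k one orbit_closure_in_K [OF one] orbit_closure_in_K [OF k(1)]
    unfolding MOC_def by metis
  moreover have "orbit_closure \<one> \<subseteq> {\<one>}"
  proof (rule closure_of_minimal)
    show "semigroup_orbit (\<lambda>\<gamma>. \<gamma>) \<Gamma> \<one> \<subseteq> {\<one>}"
      using group_hom group_hom.hom_one by (force simp: semigroup_orbit_def)
    show "closedin T {\<one>}"
      using Hausdorff by (simp add: closedin_Hausdorff_sing_eq topspace_eq_carrier)
  qed
  moreover obtain \<gamma> where \<gamma>: "\<gamma> \<in> \<Gamma>"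
    using k(2) by (cases "\<Gamma> = {}") (auto simp: semigroup_orbit_def)
  moreover have kG: "k \<in> carrier G"
    using k(1) K_subset by blast
  ultimately have "\<gamma> k = \<one>"
    using act_mem_orbit_closure [of k \<gamma>] by (auto simp: topspace_eq_carrier)
  then have "\<gamma> k = \<gamma> \<one>"
    using group_hom [OF \<gamma>] group_hom.hom_one by metis
  then show ?thesis
    using bij_betw_imp_inj_on [OF bij [OF \<gamma>]] kG by (meson inj_onD one_closed)
qed

lemma coset_subset: "x \<in> carrier G \<Longrightarrow> \<pi> x \<subseteq> carrier G"
  using K_subset by (rule l_coset_subset_G)

lemma compactin_coset:
  assumes "x \<in> carrier G"
  shows "compactin T (\<pi> x)"
proof -
  have "continuous_map T T (\<lambda>y. x \<otimes> y)"
    using assms by (intro continuous_map_group_mult) (auto simp: topspace_eq_carrier)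
  moreover have "\<pi> x = (\<lambda>y. x \<otimes> y) ` K"
    by (auto simp: l_coset_def)
  ultimately show ?thesis
    using image_compactin [OF compact] by simp
qed

text \<open>The map \<open>F \<mapsto> (F p)\<inverse> F q\<close> is continuous for pointwise convergence and sends an automorphism
  \<open>\<gamma>\<close> to \<open>\<gamma> (p\<inverse> q)\<close>. If \<open>F p = F q\<close>, then \<open>\<one>\<close> is a limit of such values, with \<open>p\<inverse> q \<in> K\<close>.\<close>

lemma inj_on_enveloping_map:
  assumes distal: "\<And>k. k \<in> K \<Longrightarrow> \<one> \<in> orbit_closure k \<Longrightarrow> k = \<one>"
    and x: "x \<in> carrier G" and F: "F \<in> enveloping_maps T \<Gamma> (\<pi> x)"
  shows "inj_on F (\<pi> x)"
proof (rule inj_onI)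
  fix p q assume p: "p \<in> \<pi> x" and q: "q \<in> \<pi> x" and eq: "F p = F q"
  have pq: "p \<in> carrier G" "q \<in> carrier G"
    using p q coset_subset [OF x] by auto
  have "inv p \<otimes> q \<in> K"
    using l_repr_independence [OF p x subgroup] q pq subgroup
    by (metis is_group subgroup.lcos_module_imp)
  moreover have "\<one> \<in> orbit_closure (inv p \<otimes> q)"
  proof -
    have "inv F p \<otimes> F q \<in> orbit_closure (inv p \<otimes> q)"
    proof (rule continuous_map_into_closure_of [where f = "\<lambda>F. inv F p \<otimes> F q"])
      show "continuous_map (product_topology (\<lambda>_. T) (\<pi> x)) T (\<lambda>F. inv F p \<otimes> F q)"
        using p q by (intro continuous_map_group_mult continuous_map_group_inv
            continuous_map_product_projection)
      show "(\<lambda>F. inv F p \<otimes> F q) ` (\<lambda>\<gamma>. restrict \<gamma> (\<pi> x)) ` \<Gamma> \<subseteq> orbit_closure (inv p \<otimes> q)"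
      proof clarify
        fix \<gamma> assume \<gamma>: "\<gamma> \<in> \<Gamma>"
        then interpret \<gamma>: group_hom G G \<gamma>
          by (rule group_hom)
        have "\<gamma> (inv p \<otimes> q) = inv \<gamma> p \<otimes> \<gamma> q"
          using pq by simp
        then show "inv restrict \<gamma> (\<pi> x) p \<otimes> restrict \<gamma> (\<pi> x) q \<in> orbit_closure (inv p \<otimes> q)"
          using act_mem_orbit_closure [of "inv p \<otimes> q" \<gamma>] \<gamma> p q pq by (simp add: topspace_eq_carrier)
      qed
      show "F \<in> product_topology (\<lambda>_. T) (\<pi> x) closure_of (\<lambda>\<gamma>. restrict \<gamma> (\<pi> x)) ` \<Gamma>"
        using F by (simp add: enveloping_maps_def)
    qed
    moreover have "F q \<in> carrier G"
    proof -
      interpret fibre: continuous_map_semigroup T \<Gamma> "\<pi> x"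
        by unfold_locales (simp add: coset_subset x topspace_eq_carrier)
      show ?thesis
        using fibre.Env_subset F q by (auto simp: topspace_eq_carrier)
    qed
    ultimately show ?thesis
      using eq by simp
  qed
  ultimately have "inv p \<otimes> q = \<one>"
    by (rule distal)
  then show "p = q"
    using pq by (metis inv_equality inv_closed inv_inv)
qed

text \<open>On \<open>x K\<close> an automorphism is determined by its value at \<open>x\<close> and its restriction to \<open>K\<close>, through
  \<open>\<gamma> q = \<gamma> x \<gamma> (x\<inverse> q)\<close>. The restrictions range over a compact space of functions \<open>K \<rightarrow> K\<close>, so the
  projection that forgets them is closed: a limit \<open>x k\<close> of values \<open>\<gamma> x\<close> comes together with a
  limit \<open>\<phi>\<close> of the restrictions, and the pair assembles to a limit of \<open>\<gamma>\<close> on all of \<open>x K\<close>.\<close>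

lemma enveloping_map_through:
  assumes x: "x \<in> carrier G" and k: "k \<in> K" and mem: "x \<otimes> k \<in> orbit_closure x"
  obtains F where "F \<in> enveloping_maps T \<Gamma> (\<pi> x)" "F \<in> \<pi> x \<rightarrow> \<pi> x" "F x = x \<otimes> k"
proof -
  define PK where "PK = product_topology (\<lambda>_. subtopology T K) K"
  define D where "D = prod_topology T PK closure_of ((\<lambda>\<gamma>. (\<gamma> x, restrict \<gamma> K)) ` \<Gamma>)"
  define \<Psi> where "\<Psi> = (\<lambda>(g, \<phi>). \<lambda>q\<in>\<pi> x. g \<otimes> \<phi> (inv x \<otimes> q))"
  have fibre: "inv x \<otimes> q \<in> K" if "q \<in> \<pi> x" for q
    using that x subgroup is_group subgroup.lcos_module_imp by metis
  have act_mem_K: "\<gamma> h \<in> K" if "\<gamma> \<in> \<Gamma>" "h \<in> K" for \<gamma> h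
    using act_K that by blast
  have topK: "topspace (subtopology T K) = K"
    using K_subset by (simp add: topspace_eq_carrier Int_absorb1)
  have compact_PK: "compact_space PK"
    using compact by (simp add: PK_def compact_space_product_topology compact_space_subtopology)
  have "closedin (prod_topology T PK) D"
    unfolding D_def by (rule closedin_closure_of)
  then have "closedin T (fst ` D)"
    using closed_map_fst [OF compact_PK, of T] unfolding closed_map_def by simp
  moreover have "semigroup_orbit (\<lambda>\<gamma>. \<gamma>) \<Gamma> x \<subseteq> fst ` D"
  proof -
    have "(\<lambda>\<gamma>. (\<gamma> x, restrict \<gamma> K)) ` \<Gamma> \<subseteq> topspace (prod_topology T PK)"
      using act_closed act_mem_K K_subset x
      by (auto simp: image_subset_iff PK_def topspace_eq_carrier subset_iff)
    then have "(\<lambda>\<gamma>. (\<gamma> x, restrict \<gamma> K)) ` \<Gamma> \<subseteq> D"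
      unfolding D_def by (rule closure_of_subset)
    then show ?thesis
      by (force simp: semigroup_orbit_def)
  qed
  ultimately have "orbit_closure x \<subseteq> fst ` D"
    by (simp add: closure_of_minimal)
  then obtain \<phi> where \<phi>: "(x \<otimes> k, \<phi>) \<in> D"
    using mem by auto
  have \<phi>_K: "\<phi> h \<in> K" if "h \<in> K" for h
    using \<phi> closure_of_subset_topspace [of "prod_topology T PK"] that
    by (fastforce simp: D_def PK_def topK)
  have cont_\<phi>: "continuous_map (prod_topology T PK) T (\<lambda>p. snd p h)" if "h \<in> K" for h
  proof -
    have "continuous_map PK T (\<lambda>\<phi>. \<phi> h)"
      using continuous_map_product_projection [OF that, of "\<lambda>_. subtopology T K"]
      by (simp add: PK_def continuous_map_in_subtopology)
    then show ?thesis
      using continuous_map_compose [OF continuous_map_snd] by (fastforce simp: o_def)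
  qed
  have \<phi>_one: "\<phi> \<one> = \<one>"
  proof -
    have one: "\<one> \<in> K"
      using subgroup by (rule subgroup.one_closed)
    have sing: "T closure_of {\<one>} = {\<one>}"
      using Hausdorff by (simp add: closure_of_eq closedin_Hausdorff_sing_eq topspace_eq_carrier)
    have "snd (x \<otimes> k, \<phi>) \<one> \<in> T closure_of {\<one>}"
    proof (rule continuous_map_into_closure_of [OF cont_\<phi> [OF one]])
      show "(\<lambda>p. snd p \<one>) ` (\<lambda>\<gamma>. (\<gamma> x, restrict \<gamma> K)) ` \<Gamma> \<subseteq> T closure_of {\<one>}"
        using one group_hom.hom_one [OF group_hom] by (auto simp: sing)
    qed (use \<phi> in \<open>simp add: D_def\<close>)
    then show ?thesis
      by (simp add: sing)
  qed
  show thesis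
  proof
    show "\<Psi> (x \<otimes> k, \<phi>) \<in> enveloping_maps T \<Gamma> (\<pi> x)"
      unfolding enveloping_maps_def
    proof (rule continuous_map_into_closure_of [where f = \<Psi>])
      show "continuous_map (prod_topology T PK) (product_topology (\<lambda>_. T) (\<pi> x)) \<Psi>"
        unfolding continuous_map_componentwise
      proof (intro conjI ballI)
        fix q assume q: "q \<in> \<pi> x"
        have "continuous_map (prod_topology T PK) T (\<lambda>p. fst p \<otimes> snd p (inv x \<otimes> q))"
          by (intro continuous_map_group_mult continuous_map_fst cont_\<phi> fibre q)
        then show "continuous_map (prod_topology T PK) T (\<lambda>p. \<Psi> p q)"
          using q by (simp add: \<Psi>_def case_prod_unfold)
      qed (auto simp: \<Psi>_def)
      have "\<Psi> (\<gamma> x, restrict \<gamma> K) = restrict \<gamma> (\<pi> x)" if \<gamma>: "\<gamma> \<in> \<Gamma>" for \<gamma>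
      proof -
        interpret \<gamma>: group_hom G G \<gamma>
          using \<gamma> by (rule group_hom)
        have "\<gamma> x \<otimes> \<gamma> (inv x \<otimes> q) = \<gamma> q" if "q \<in> \<pi> x" for q
        proof -
          have q: "q \<in> carrier G"
            using that coset_subset [OF x] by blast
          have "\<gamma> x \<otimes> \<gamma> (inv x \<otimes> q) = \<gamma> (x \<otimes> (inv x \<otimes> q))"
            using x q by simp
          then show ?thesis
            using x q by (simp add: m_assoc [symmetric])
        qed
        then show ?thesis
          using fibre by (auto simp: \<Psi>_def fun_eq_iff)
      qed
      moreover have "(\<lambda>\<gamma>. restrict \<gamma> (\<pi> x)) ` \<Gamma> \<subseteq>
          product_topology (\<lambda>_. T) (\<pi> x) closure_of (\<lambda>\<gamma>. restrict \<gamma> (\<pi> x)) ` \<Gamma>"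
        using act_closed coset_subset [OF x]
        by (intro closure_of_subset) (auto simp: topspace_eq_carrier subset_iff)
      ultimately show "\<Psi> ` (\<lambda>\<gamma>. (\<gamma> x, restrict \<gamma> K)) ` \<Gamma> \<subseteq>
          product_topology (\<lambda>_. T) (\<pi> x) closure_of (\<lambda>\<gamma>. restrict \<gamma> (\<pi> x)) ` \<Gamma>"
        by (simp add: image_image)
      show "(x \<otimes> k, \<phi>) \<in> prod_topology T PK closure_of (\<lambda>\<gamma>. (\<gamma> x, restrict \<gamma> K)) ` \<Gamma>"
        using \<phi> by (simp add: D_def)
    qed
    show "\<Psi> (x \<otimes> k, \<phi>) \<in> \<pi> x \<rightarrow> \<pi> x"
    proof
      fix q assume q: "q \<in> \<pi> x"
      define h where "h = \<phi> (inv x \<otimes> q)"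
      have h: "h \<in> K"
        using \<phi>_K fibre [OF q] by (simp add: h_def)
      have "k \<in> carrier G" "h \<in> carrier G"
        using k h K_subset by auto
      then have "x \<otimes> k \<otimes> h = x \<otimes> (k \<otimes> h)"
        using x by (simp add: m_assoc)
      moreover have "k \<otimes> h \<in> K"
        using subgroup k h by (rule subgroup.m_closed)
      ultimately show "\<Psi> (x \<otimes> k, \<phi>) q \<in> \<pi> x"
        using q by (auto simp: \<Psi>_def h_def l_coset_def)
    qed
    have "k \<in> carrier G"
      using k K_subset by blast
    then show "\<Psi> (x \<otimes> k, \<phi>) x = x \<otimes> k"
      using lcos_self [OF x subgroup] x \<phi>_one by (simp add: \<Psi>_def)
  qed
qed

lemma return_within_fibre:
  assumes MOC: "MOC (subtopology T K) (\<lambda>\<gamma>. \<gamma>) \<Gamma>"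
    and x: "x \<in> carrier G" and k: "k \<in> K" and mem: "x \<otimes> k \<in> orbit_closure x"
  shows "x \<in> orbit_closure (x \<otimes> k)"
proof -
  interpret fibre: continuous_map_semigroup T \<Gamma> "\<pi> x"
    by unfold_locales (simp add: coset_subset x topspace_eq_carrier)
  obtain F where F: "F \<in> enveloping_maps T \<Gamma> (\<pi> x)" "F \<in> \<pi> x \<rightarrow> \<pi> x" "F x = x \<otimes> k"
    using enveloping_map_through [OF x k mem] .
  have "inj_on E (\<pi> x)" if "E \<in> enveloping_maps T \<Gamma> (\<pi> x)" for E
    using inj_on_enveloping_map [OF MOC_subgroup_imp_distal [OF MOC] x that] .
  then show ?thesis
    using fibre.recurrence_from_injectivity [OF Hausdorff compactin_coset [OF x] _ F(1,2)
        lcos_self [OF x subgroup]] F(3) by simp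
qed

section \<open>Extension by a compact subgroup\<close>

lemma MOC_extension:
  assumes MOC_K: "MOC (subtopology T K) (\<lambda>\<gamma>. \<gamma>) \<Gamma>" and MOC_quot: "MOC quotient coset_action \<Gamma>"
  shows "MOC T (\<lambda>\<gamma>. \<gamma>) \<Gamma>"
proof (rule MOC_if_symmetric)
  fix x y
  assume "x \<in> topspace T" "y \<in> topspace T" and y_mem: "y \<in> orbit_closure x"
  then have x: "x \<in> carrier G" and y: "y \<in> carrier G"
    by (simp_all add: topspace_eq_carrier)
  have \<pi>x: "\<pi> x \<in> topspace quotient"
    using x by (simp add: topspace_coset_topology)
  have nonempty: "\<Gamma> \<noteq> {}"
    using y_mem by (auto simp: semigroup_orbit_def)
  have "\<pi> y \<in> quotient.orbit_closure (\<pi> x)"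
    using y_mem by (simp add: orbit_closure_in_quotient x)
  then have "quotient.orbit_closure (\<pi> y) = quotient.orbit_closure (\<pi> x)"
    by (rule quotient.MOC_eq [OF MOC_quot \<pi>x])
  moreover have "\<pi> x \<in> quotient.orbit_closure (\<pi> x)"
    using quotient.MOC_imp_mem_orbit_closure [OF MOC_quot nonempty] \<pi>x
      coset_action_image_topspace inj_on_coset_action by blast
  ultimately have "\<pi> x \<in> \<pi> ` orbit_closure y"
    by (simp add: orbit_closure_in_quotient y)
  then obtain z where z: "z \<in> orbit_closure y" "\<pi> z = \<pi> x"
    by auto
  have "z \<in> carrier G"
    using z(1) orbit_closure_subset by blast
  then obtain k where k: "k \<in> K" "x \<otimes> k = z"
    using z(2) l_coset_eq_iff [OF subgroup _ x] by blast
  have "z \<in> orbit_closure x"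
    using orbit_closure_mono [OF _ y_mem] z(1) x by (auto simp: topspace_eq_carrier)
  then have "x \<in> orbit_closure z"
    using return_within_fibre [OF MOC_K x k(1)] k(2) by simp
  also have "\<dots> \<subseteq> orbit_closure y"
    using orbit_closure_mono z(1) y by (simp add: topspace_eq_carrier)
  finally show "x \<in> orbit_closure y" .
qed

end

theorem theorem1p2:
  fixes G :: "('a, 'b) monoid_scheme" and T :: "'a topology"
    and \<Gamma> :: "('a \<Rightarrow> 'a) set" and K :: "'a set"
  assumes "topological_group G T"
    and "Hausdorff_space T"
    and "locally_compact_space T"
    and "subsemigroup \<Gamma> (top_AutoGroup G T)"
    and "subgroup K G"
    and "compactin T K"
    and "metrizable_space (subtopology T K)"
    and "invariant_under \<Gamma> K"
  shows "MOC T (\<lambda>\<gamma>. \<gamma>) \<Gamma> \<longleftrightarrow>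
    MOC (subtopology T K) (\<lambda>\<gamma>. \<gamma>) \<Gamma> \<and> MOC (coset_topology G T K) coset_action \<Gamma>"
proof -
  interpret automorphisms_with_compact_subgroup G T \<Gamma> K
    using assms by (simp add: automorphisms_with_compact_subgroup_def automorphism_semigroup_def
        automorphisms_with_compact_subgroup_axioms_def automorphism_semigroup_axioms_def)
  show ?thesis
    using MOC_subgroup MOC_quotient MOC_extension by blast
qed

end
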